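(* Let $m,n$ be integers with $1\le m<n$ and $q$ a prime power, with $n+q\to\infty$. Let $X$ be a random set of points of $\mathbb{F}_q^n$, each point included independently with probability $\theta$, and let $Y$ be a random set of $m$-flats of $\mathbb{F}_q^n$, each $m$-flat included independently (of each other and of $X$) with probability $\theta$. Let $\Gamma$ be the event that there is a pair $(x,y)\in X\times Y$ with $x\in y$. If $m\in\{1,n-1\}$, then $q^{-\frac12((n-m)(m+1)+m)}$ is a threshold for $\Gamma$; otherwise $q^{-n}$ is a threshold for $\Gamma$.
   Context: An $m$-flat in $\mathbb{F}_q^n$ is a translate of an $m$-dimensional linear subspace. A function $t$ is a threshold for $\Gamma$ if $\Pr[\Gamma]\to0$ whenever $\theta=o(t)$ and $\Pr[\Gamma]\to1$ whenever $\theta=\omega(t)$. *)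

theory Defs
  imports
    "HOL-Algebra.AbelCoset"
    "HOL-Probability.Probability"
    "HOL-Number_Theory.Prime_Powers"
    "Jordan_Normal_Form.Missing_VectorSpace"
begin

abbreviation coord_space :: "('a, 'c) ring_scheme \<Rightarrow> nat \<Rightarrow> ('a, nat \<Rightarrow> 'a) module" where
  "coord_space K n \<equiv> ring.func_space K {..<n}"

(* The additive left coset v <+ W is the translate {v + w | w in W}.  A flat is the point set
   itself, so translates of W that coincide are one flat. *)
definition flats :: "('a, 'c) ring_scheme \<Rightarrow> nat \<Rightarrow> nat \<Rightarrow> (nat \<Rightarrow> 'a) set set" where
  "flats K n m =
    {v <+\<^bsub>coord_space K n\<^esub> W | v W.
       v \<in> carrier (coord_space K n) \<and>
       VectorSpace.subspace K W (coord_space K n) \<and>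
       vectorspace.dim K ((coord_space K n)\<lparr>carrier := W\<rparr>) = m}"

(* Only meaningful for finite A and 0 <= p <= 1: Pi_pmf is degenerate on infinite sets and
   bernoulli_pmf clamps its parameter to [0, 1]. *)
definition random_subset :: "'b set \<Rightarrow> real \<Rightarrow> 'b set pmf" where
  "random_subset A p = map_pmf (\<lambda>f. {x \<in> A. f x}) (Pi_pmf A False (\<lambda>_. bernoulli_pmf p))"

definition incidence_prob :: "('a, 'c) ring_scheme \<Rightarrow> nat \<Rightarrow> nat \<Rightarrow> real \<Rightarrow> real" where
  "incidence_prob K n m p =
    measure_pmf.prob
      (pair_pmf (random_subset (carrier (coord_space K n)) p) (random_subset (flats K n m) p))
      {(X, Y). \<exists>x\<in>X. \<exists>y\<in>Y. x \<in> y}"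

(* P k p is the probability of the k-th event when the density parameter is p. *)
definition is_threshold :: "(nat \<Rightarrow> real \<Rightarrow> real) \<Rightarrow> (nat \<Rightarrow> real) \<Rightarrow> bool" where
  "is_threshold P t \<longleftrightarrow>
    (\<forall>\<theta> :: nat \<Rightarrow> real. (\<forall>k. 0 \<le> \<theta> k \<and> \<theta> k \<le> 1) \<longrightarrow>
       (\<theta> \<in> o(t) \<longrightarrow> (\<lambda>k. P k (\<theta> k)) \<longlonglongrightarrow> 0) \<and>
       (\<theta> \<in> \<omega>(t) \<longrightarrow> (\<lambda>k. P k (\<theta> k)) \<longlonglongrightarrow> 1))"

end

theory Submission
  imports Defs
begin

text \<open>
  Let \<open>d\<close> be the number of \<open>m\<close>-dimensional subspaces of \<open>K^n\<close>, so that each point lies on \<open>d\<close> flats and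
  there are \<open>N = q^n d\<close> incidences. By the union bound, the probability of \<open>\<Gamma>\<close> is at most \<open>\<theta>^2 N\<close> and
  at most \<open>\<theta> q^n\<close>. Conversely, since the incidence graph is biregular, Chebyshev's inequality bounds
  the probability of no incidence by \<open>1/(\<theta>^2 N) + 1/(\<theta> q^n) + 1/(\<theta> F)\<close>, where \<open>F\<close> is the number
  of flats. It remains to estimate \<open>d\<close>. The graphs of the linear maps from \<open>K^m\<close> to \<open>K^(n-m)\<close> give
  \<open>d \<ge> q^(m(n-m))\<close>, hence \<open>F \<ge> q^n\<close> always and \<open>d \<ge> q^n\<close> for \<open>2 \<le> m \<le> n - 2\<close>; for lines and hyperplanes
  \<open>d\<close> lies between \<open>q^(n-1)\<close> and \<open>2 q^(n-1)\<close>.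
\<close>

subsection \<open>Random subgraphs of biregular bipartite graphs\<close>

lemma finite_set_pmf_random_subset:
  assumes "finite A"
  shows "finite (set_pmf (random_subset A p))"
  by (rule finite_subset[of _ "Pow A"]) (auto simp: random_subset_def assms)

text \<open>The event restricts each coordinate of the product separately, to \<open>True\<close> on
  \<open>S\<close> and not at all elsewhere, so independence turns its probability into a
  product.\<close>

lemma prob_superset_random_subset:
  assumes "finite A" "S \<subseteq> A" "0 \<le> p" "p \<le> 1"
  shows "measure_pmf.prob (random_subset A p) {X. S \<subseteq> X} = p ^ card S"
proof -
  let ?B = "\<lambda>x. if x \<in> S then {True} else UNIV"
  have eq: "(\<lambda>f. {x \<in> A. f x}) -` {X. S \<subseteq> X} = Pi A ?B"
    using assms(2) by (auto simp: Pi_def)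
  have "measure_pmf.prob (random_subset A p) {X. S \<subseteq> X}
      = (\<Prod>x\<in>A. measure_pmf.prob (bernoulli_pmf p) (?B x))"
    unfolding random_subset_def measure_map_pmf eq
    using assms by (intro measure_Pi_pmf_Pi) auto
  also have "\<dots> = (\<Prod>x\<in>A. if x \<in> S then p else 1)"
    using assms by (intro prod.cong refl) (auto simp: measure_pmf_single)
  also have "\<dots> = (\<Prod>x\<in>S. p)"
    using assms by (subst prod.inter_restrict[symmetric]) (auto simp: Int_absorb1)
  finally show ?thesis by simp
qed

text \<open>Both events may be cut down to the finite supports, and for countable events the product
  rule is available.\<close>

lemma prob_pair_pmf_Times:
  assumes "finite (set_pmf M)" "finite (set_pmf N)"
  shows "measure_pmf.prob (pair_pmf M N) (A \<times> B) = measure_pmf.prob M A * measure_pmf.prob N B"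
proof -
  have "measure_pmf.prob (pair_pmf M N) (A \<times> B)
      = measure_pmf.prob (pair_pmf M N) ((A \<inter> set_pmf M) \<times> (B \<inter> set_pmf N))"
    by (subst (1) measure_Int_set_pmf[symmetric])
       (auto intro!: arg_cong[where f = "measure_pmf.prob _"])
  also have "\<dots> = measure_pmf.prob M (A \<inter> set_pmf M) * measure_pmf.prob N (B \<inter> set_pmf N)"
    using assms by (intro measure_pmf_prob_product countable_finite) auto
  finally show ?thesis by (simp add: measure_Int_set_pmf)
qed

locale random_pair =
  fixes A :: "'b set" and B :: "'c set" and p :: real
  assumes fin: "finite A" "finite B" and p: "0 \<le> p" "p \<le> 1"
begin

definition pair :: "('b set \<times> 'c set) pmf" where
  "pair = pair_pmf (random_subset A p) (random_subset B p)"

definition hit :: "'b \<times> 'c \<Rightarrow> 'b set \<times> 'c set \<Rightarrow> real" where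
  "hit e = indicator {(X, Y). fst e \<in> X \<and> snd e \<in> Y}"

lemma integrable_pair [simp]: "integrable (measure_pmf pair) (f :: _ \<Rightarrow> real)"
  by (intro integrable_measure_pmf_finite)
     (simp add: pair_def fin finite_set_pmf_random_subset)

text \<open>Every probability computed below reduces to this form: one edge, two edges, or a single
  left vertex with \<open>T = {}\<close>.\<close>

lemma prob_pair_supersets:
  assumes "S \<subseteq> A" "T \<subseteq> B"
  shows "measure_pmf.prob pair {(X, Y). S \<subseteq> X \<and> T \<subseteq> Y} = p ^ card S * p ^ card T"
proof -
  have "{(X, Y). S \<subseteq> X \<and> T \<subseteq> Y} = {X. S \<subseteq> X} \<times> {Y. T \<subseteq> Y}" by auto
  then show ?thesis
    using assms fin p
    by (simp add: pair_def prob_pair_pmf_Times finite_set_pmf_random_subset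
        prob_superset_random_subset)
qed

lemma expectation_hit:
  assumes "e \<in> A \<times> B"
  shows "measure_pmf.expectation pair (hit e) = p\<^sup>2"
  using prob_pair_supersets[of "{fst e}" "{snd e}"] assms
  by (auto simp: hit_def power2_eq_square)

text \<open>Two edges survive together iff all their endpoints do. Counting endpoints by
  \<open>card\<close> of a pair set treats shared and distinct endpoints in one formula.\<close>

lemma expectation_hit_mult:
  assumes "e \<in> A \<times> B" "f \<in> A \<times> B"
  shows "measure_pmf.expectation pair (\<lambda>\<omega>. hit e \<omega> * hit f \<omega>)
       = p ^ card {fst e, fst f} * p ^ card {snd e, snd f}"
proof -
  have "(\<lambda>\<omega>. hit e \<omega> * hit f \<omega>)
      = indicator {(X, Y). {fst e, fst f} \<subseteq> X \<and> {snd e, snd f} \<subseteq> Y}"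
    by (auto simp: hit_def fun_eq_iff indicator_def)
  then show ?thesis
    using prob_pair_supersets[of "{fst e, fst f}" "{snd e, snd f}"] assms by auto
qed

text \<open>Union bound over the edges, each of which survives with probability
  \<open>p\<^sup>2\<close>.\<close>

lemma prob_edge_le_card_edges:
  assumes "E \<subseteq> A \<times> B"
  shows "measure_pmf.prob pair {(X, Y). \<exists>x\<in>X. \<exists>y\<in>Y. (x, y) \<in> E} \<le> p\<^sup>2 * card E"
proof -
  have E: "finite E" using assms fin finite_subset by blast
  have "measure_pmf.prob pair {(X, Y). \<exists>x\<in>X. \<exists>y\<in>Y. (x, y) \<in> E}
      \<le> measure_pmf.prob pair (\<Union>e\<in>E. {(X, Y). {fst e} \<subseteq> X \<and> {snd e} \<subseteq> Y})"
    by (intro measure_pmf.finite_measure_mono) auto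
  also have "\<dots> \<le> (\<Sum>e\<in>E. measure_pmf.prob pair {(X, Y). {fst e} \<subseteq> X \<and> {snd e} \<subseteq> Y})"
    using E by (intro measure_pmf.finite_measure_subadditive_finite) auto
  also have "\<dots> = (\<Sum>e\<in>E. p\<^sup>2)"
    using assms by (intro sum.cong refl, subst prob_pair_supersets) (auto simp: power2_eq_square)
  finally show ?thesis by (simp add: mult.commute)
qed

text \<open>A surviving edge forces \<open>X\<close> to be nonempty, so a union bound over the left
  vertices suffices. In a left-regular graph this is the sharper bound once \<open>p\<close> times
  the left degree exceeds 1.\<close>

lemma prob_edge_le_card_left:
  assumes "E \<subseteq> A \<times> B"
  shows "measure_pmf.prob pair {(X, Y). \<exists>x\<in>X. \<exists>y\<in>Y. (x, y) \<in> E} \<le> p * card A"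
proof -
  have "measure_pmf.prob pair {(X, Y). \<exists>x\<in>X. \<exists>y\<in>Y. (x, y) \<in> E}
      \<le> measure_pmf.prob pair (\<Union>a\<in>A. {(X, Y). {a} \<subseteq> X \<and> {} \<subseteq> Y})"
    using assms by (intro measure_pmf.finite_measure_mono) auto
  also have "\<dots> \<le> (\<Sum>a\<in>A. measure_pmf.prob pair {(X, Y). {a} \<subseteq> X \<and> {} \<subseteq> Y})"
    using fin by (intro measure_pmf.finite_measure_subadditive_finite) auto
  also have "\<dots> = (\<Sum>a\<in>A. p)"
    by (intro sum.cong refl, subst prob_pair_supersets) auto
  finally show ?thesis by (simp add: mult.commute)
qed

text \<open>Second moment method for the number \<open>Z\<close> of surviving edges. Vertex-disjoint
  pairs of edges contribute no more than the squared mean; equal edges, pairs sharing a left vertex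
  and pairs sharing a right vertex give the three error terms in this order.\<close>

lemma prob_edge_ge:
  assumes E: "E \<subseteq> A \<times> B" "E \<noteq> {}" and "0 < p"
    and degA: "\<And>x. x \<in> A \<Longrightarrow> card {y. (x, y) \<in> E} = a"
    and degB: "\<And>y. y \<in> B \<Longrightarrow> card {x. (x, y) \<in> E} = b"
  shows "measure_pmf.prob pair {(X, Y). \<exists>x\<in>X. \<exists>y\<in>Y. (x, y) \<in> E}
       \<ge> 1 - (1 / (p\<^sup>2 * card E) + 1 / (p * card A) + 1 / (p * card B))"
proof -
  have finE: "finite E" using E fin finite_subset by blast
  then have N: "0 < card E" using E by (simp add: card_gt_0_iff)
  have NA: "card E = card A * a"
  proof -
    have "E = (SIGMA x:A. {y. (x, y) \<in> E})" using E by auto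
    then have "card E = card (SIGMA x:A. {y. (x, y) \<in> E})" by (rule arg_cong[where f = card])
    also have "\<dots> = (\<Sum>x\<in>A. card {y. (x, y) \<in> E})"
      using fin E by (intro card_SigmaI) (auto intro!: finite_subset[OF _ fin(2)])
    finally show ?thesis using degA by simp
  qed
  have NB: "card E = card B * b"
  proof -
    have "prod.swap ` E = (SIGMA y:B. {x. (x, y) \<in> E})" using E by auto
    then have "card E = card (SIGMA y:B. {x. (x, y) \<in> E})"
      using card_image[OF inj_on_subset[OF inj_swap subset_UNIV], of E] by metis
    also have "\<dots> = (\<Sum>y\<in>B. card {x. (x, y) \<in> E})"
      using fin E by (intro card_SigmaI) (auto intro!: finite_subset[OF _ fin(1)])
    finally show ?thesis using degB by simp
  qed
  define Z where "Z = (\<lambda>\<omega>. \<Sum>e\<in>E. hit e \<omega>)"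
  define \<mu> where "\<mu> = p\<^sup>2 * card E"
  have mu_pos: "0 < \<mu>" using N \<open>0 < p\<close> by (simp add: \<mu>_def)
  have EZ: "measure_pmf.expectation pair Z = \<mu>"
  proof -
    have "measure_pmf.expectation pair Z = (\<Sum>e\<in>E. measure_pmf.expectation pair (hit e))"
      by (simp add: Z_def Bochner_Integration.integral_sum)
    also have "\<dots> = (\<Sum>e\<in>E. p\<^sup>2)"
      using E by (intro sum.cong refl expectation_hit) auto
    finally show ?thesis by (simp add: \<mu>_def mult.commute)
  qed
  \<comment> \<open>Ordered pairs of edges with a common left endpoint: each edge has
    \<open>a\<close> partners, itself included.\<close>
  have sumA: "(\<Sum>e\<in>E. \<Sum>f\<in>E. of_bool (fst e = fst f) :: real) = card E * a"
  proof -
    have "(\<Sum>f\<in>E. of_bool (fst e = fst f) :: real) = a" if "e \<in> E" for e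
    proof -
      have "E \<inter> {f. fst e = fst f} = Pair (fst e) ` {y. (fst e, y) \<in> E}" by auto
      then have "card (E \<inter> {f. fst e = fst f}) = card {y. (fst e, y) \<in> E}"
        by (simp add: card_image inj_on_def)
      also have "\<dots> = a" using that E by (intro degA) auto
      finally show ?thesis using finE by simp
    qed
    then show ?thesis by simp
  qed
  have sumB: "(\<Sum>e\<in>E. \<Sum>f\<in>E. of_bool (snd e = snd f) :: real) = card E * b"
  proof -
    have "(\<Sum>f\<in>E. of_bool (snd e = snd f) :: real) = b" if "e \<in> E" for e
    proof -
      have "E \<inter> {f. snd e = snd f} = (\<lambda>x. (x, snd e)) ` {x. (x, snd e) \<in> E}" by force
      then have "card (E \<inter> {f. snd e = snd f}) = card {x. (x, snd e) \<in> E}"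
        by (simp add: card_image inj_on_def)
      also have "\<dots> = b" using that E by (intro degB) auto
      finally show ?thesis using finE by simp
    qed
    then show ?thesis by simp
  qed
  have sumAB: "(\<Sum>e\<in>E. \<Sum>f\<in>E. of_bool (e = f) :: real) = card E"
    using finE by (simp add: of_bool_def)
  have "measure_pmf.expectation pair (\<lambda>\<omega>. (Z \<omega>)\<^sup>2)
      = (\<Sum>e\<in>E. \<Sum>f\<in>E. measure_pmf.expectation pair (\<lambda>\<omega>. hit e \<omega> * hit f \<omega>))"
    by (simp add: Z_def power2_eq_square sum_product Bochner_Integration.integral_sum)
  also have "\<dots> = (\<Sum>e\<in>E. \<Sum>f\<in>E. p ^ card {fst e, fst f} * p ^ card {snd e, snd f})"
    using E by (intro sum.cong refl expectation_hit_mult) auto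
  \<comment> \<open>Expands \<open>p ^ card {x, x'} \<le> p\<^sup>2 + p * of_bool (x = x')\<close>, likewise for the second components.\<close>
  also have "\<dots> \<le> (\<Sum>e\<in>E. \<Sum>f\<in>E. p ^ 4 + p ^ 3 * of_bool (fst e = fst f)
      + p ^ 3 * of_bool (snd e = snd f) + p\<^sup>2 * of_bool (e = f))"
    using p by (intro sum_mono)
      (auto simp: prod_eq_iff card_insert_if numeral_eq_Suc mult.assoc)
  also have "\<dots> = p ^ 4 * (card E)\<^sup>2 + p ^ 3 * (card E * a) + p ^ 3 * (card E * b) + p\<^sup>2 * card E"
    by (simp add: sum.distrib sum_distrib_left[symmetric] sumA sumB sumAB power2_eq_square)
  finally have EZ2: "measure_pmf.expectation pair (\<lambda>\<omega>. (Z \<omega>)\<^sup>2)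
      \<le> \<mu>\<^sup>2 + p ^ 3 * (card E * a) + p ^ 3 * (card E * b) + p\<^sup>2 * card E"
    by (simp add: \<mu>_def power_mult_distrib flip: power_mult)
  have "measure_pmf.variance pair Z
      = measure_pmf.expectation pair (\<lambda>\<omega>. (Z \<omega>)\<^sup>2) - \<mu>\<^sup>2"
    by (subst measure_pmf.variance_eq) (auto simp: EZ)
  with EZ2 have var: "measure_pmf.variance pair Z
      \<le> p ^ 3 * (card E * a) + p ^ 3 * (card E * b) + p\<^sup>2 * card E" by linarith
  \<comment> \<open>Without a surviving edge \<open>Z\<close> is 0 and thus deviates from its mean
    by the full amount \<open>\<mu>\<close>.\<close>
  have "1 - measure_pmf.prob pair {(X, Y). \<exists>x\<in>X. \<exists>y\<in>Y. (x, y) \<in> E}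
      = measure_pmf.prob pair (space (measure_pmf pair) - {(X, Y). \<exists>x\<in>X. \<exists>y\<in>Y. (x, y) \<in> E})"
    by (subst measure_pmf.prob_compl) auto
  also have "\<dots> \<le> measure_pmf.prob pair
      {\<omega> \<in> space (measure_pmf pair). \<mu> \<le> \<bar>Z \<omega> - measure_pmf.expectation pair Z\<bar>}"
  proof (intro measure_pmf.finite_measure_mono subsetI)
    fix \<omega> assume "\<omega> \<in> space (measure_pmf pair) - {(X, Y). \<exists>x\<in>X. \<exists>y\<in>Y. (x, y) \<in> E}"
    then have "Z \<omega> = 0"
      unfolding Z_def by (intro sum.neutral) (auto simp: hit_def indicator_def)
    then show "\<omega> \<in> {\<omega> \<in> space (measure_pmf pair). \<mu> \<le> \<bar>Z \<omega> - measure_pmf.expectation pair Z\<bar>}"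
      by (simp add: EZ)
  qed auto
  also have "\<dots> \<le> measure_pmf.variance pair Z / \<mu>\<^sup>2"
    using mu_pos by (intro measure_pmf.Chebyshev_inequality) auto
  also have "\<dots> \<le> (p ^ 3 * (card E * a) + p ^ 3 * (card E * b) + p\<^sup>2 * card E) / \<mu>\<^sup>2"
    using var by (intro divide_right_mono) auto
  also have "\<dots> = 1 / (p\<^sup>2 * card E) + a / (p * card E) + b / (p * card E)"
    using N \<open>0 < p\<close> by (simp add: \<mu>_def field_simps power2_eq_square power3_eq_cube power4_eq_xxxx)
  \<comment> \<open>Biregularity enters here: \<open>card E\<close> is \<open>card A * a\<close>,
    and the degree cancels. It is nonzero because \<open>E\<close> is nonempty.\<close>
  also have "a / (p * card E) = 1 / (p * card A)"
    using N \<open>0 < p\<close> unfolding NA by (auto simp: field_simps)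
  also have "b / (p * card E) = 1 / (p * card B)"
    using N \<open>0 < p\<close> unfolding NB by (auto simp: field_simps)
  finally show ?thesis by simp
qed

end

subsection \<open>Subspaces and flats over a finite field\<close>

text \<open>Used for both upper bounds on numbers of subspaces: nonzero vectors of lines and normal
  vectors of hyperplanes form such families.\<close>

lemma card_mult_le_card_of_disjoint_family:
  assumes "finite U" "\<And>x. x \<in> F \<Longrightarrow> C x \<subseteq> U" "\<And>x. x \<in> F \<Longrightarrow> k \<le> card (C x)"
    and "\<And>x y. x \<in> F \<Longrightarrow> y \<in> F \<Longrightarrow> x \<noteq> y \<Longrightarrow> C x \<inter> C y = {}" and "finite F"
  shows "card F * k \<le> card U"
proof -
  have "card F * k \<le> (\<Sum>x\<in>F. card (C x))"
    using sum_mono[of F "\<lambda>_. k" "\<lambda>x. card (C x)"] assms(3) by simp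
  also have "\<dots> = card (\<Union>x\<in>F. C x)"
    using assms by (intro card_UN_disjoint[symmetric]) (auto intro: finite_subset)
  also have "\<dots> \<le> card U"
    using assms by (intro card_mono) auto
  finally show ?thesis .
qed

text \<open>Closure under negation comes from scaling by minus one.\<close>

lemma (in module) submodule_imp_subgroup:
  assumes "submodule R N M"
  shows "subgroup N (add_monoid M)"
proof -
  interpret N: submodule R N M by fact
  have "\<ominus>\<^bsub>M\<^esub> v \<in> N" if "v \<in> N" for v
  proof -
    have "(\<ominus>\<^bsub>R\<^esub> \<one>\<^bsub>R\<^esub>) \<odot>\<^bsub>M\<^esub> v \<in> N" using that by simp
    also have "(\<ominus>\<^bsub>R\<^esub> \<one>\<^bsub>R\<^esub>) \<odot>\<^bsub>M\<^esub> v = \<ominus>\<^bsub>M\<^esub> v"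
      using that N.subset by (subst smult_minus_1) auto
    finally show ?thesis .
  qed
  moreover have "N \<noteq> {}" using N.zero_closed by blast
  ultimately show ?thesis
    using N.subset by (intro M.add.subgroupI) (auto simp: a_inv_def)
qed

text \<open>A coset containing \<open>x\<close> can be rewritten with \<open>x\<close> as its
  representative, and cancelling \<open>x\<close> recovers the submodule. Hence the number of flats
  through a point does not depend on the point.\<close>

lemma (in module) bij_betw_cosets_through_point:
  assumes x: "x \<in> carrier M" and S: "\<And>N. N \<in> S \<Longrightarrow> submodule R N M"
  shows "bij_betw (\<lambda>N. x <+\<^bsub>M\<^esub> N) S {v <+\<^bsub>M\<^esub> N | v N. v \<in> carrier M \<and> N \<in> S \<and> x \<in> v <+\<^bsub>M\<^esub> N}"
proof (rule bij_betw_imageI)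
  have sub: "N \<subseteq> N'" if "x <+\<^bsub>M\<^esub> N = x <+\<^bsub>M\<^esub> N'" "N \<in> S" "N' \<in> S" for N N'
  proof
    fix w assume "w \<in> N"
    then have "x \<oplus>\<^bsub>M\<^esub> w \<in> x <+\<^bsub>M\<^esub> N'"
      using that(1) unfolding a_l_coset_def' by blast
    then obtain w' where w': "w' \<in> N'" "x \<oplus>\<^bsub>M\<^esub> w = x \<oplus>\<^bsub>M\<^esub> w'"
      unfolding a_l_coset_def' by blast
    moreover have "w \<in> carrier M" "w' \<in> carrier M"
      using \<open>w \<in> N\<close> w'(1) S that submodule.subset by blast+
    ultimately show "w \<in> N'" using x by simp
  qed
  show "inj_on (\<lambda>N. x <+\<^bsub>M\<^esub> N) S"
    using sub by (metis inj_onI subset_antisym)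
  have "x \<in> x <+\<^bsub>M\<^esub> N" if "N \<in> S" for N
    using submodule.zero_closed[OF S[OF that]] x unfolding a_l_coset_def' by force
  moreover have "v <+\<^bsub>M\<^esub> N = x <+\<^bsub>M\<^esub> N" if "v \<in> carrier M" "N \<in> S" "x \<in> v <+\<^bsub>M\<^esub> N" for v N
    using that S by (intro M.a_l_repr_independence submodule_imp_subgroup) auto
  ultimately show "(\<lambda>N. x <+\<^bsub>M\<^esub> N) ` S
      = {v <+\<^bsub>M\<^esub> N | v N. v \<in> carrier M \<and> N \<in> S \<and> x \<in> v <+\<^bsub>M\<^esub> N}"
    using x by blast
qed

lemma (in module) card_coset:
  assumes "x \<in> carrier M" "N \<subseteq> carrier M"
  shows "card (x <+\<^bsub>M\<^esub> N) = card N"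
proof -
  have "x <+\<^bsub>M\<^esub> N = (\<lambda>w. x \<oplus>\<^bsub>M\<^esub> w) ` N" unfolding a_l_coset_def' by blast
  moreover have "inj_on (\<lambda>w. x \<oplus>\<^bsub>M\<^esub> w) N"
    using assms by (intro inj_onI) (simp add: subset_iff)
  ultimately show ?thesis by (simp add: card_image)
qed

lemma (in vectorspace) fin_dim_of_finite:
  assumes "finite (carrier V)"
  shows "fin_dim"
proof -
  have "span (carrier V) = carrier V"
    using span_is_subset2[of "carrier V"] in_own_span[of "carrier V"] by auto
  then show ?thesis using assms unfolding fin_dim_def by blast
qed

text \<open>A finite basis identifies vectors with coefficient functions; taking these extensional
  makes the coefficients unique.\<close>

lemma (in vectorspace) card_carrier_eq_power_dim:
  assumes "finite (carrier V)"
  shows "card (carrier V) = card (carrier K) ^ dim"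
proof -
  obtain B where B: "finite B" "basis B"
    using finite_basis_exists[OF fin_dim_of_finite[OF assms]] by blast
  then have BV: "B \<subseteq> carrier V" by (simp add: basis_def)
  have ex1: "\<exists>!a. a \<in> B \<rightarrow>\<^sub>E carrier K \<and> lincomb a B = v" if "v \<in> carrier V" for v
    using basis_criterion[OF B(1) BV] B(2) that by blast
  have closed: "lincomb a B \<in> carrier V" if "a \<in> B \<rightarrow>\<^sub>E carrier K" for a
    using that BV by (intro lincomb_closed) auto
  have "bij_betw (\<lambda>a. lincomb a B) (B \<rightarrow>\<^sub>E carrier K) (carrier V)"
  proof (rule bij_betw_imageI)
    show "inj_on (\<lambda>a. lincomb a B) (B \<rightarrow>\<^sub>E carrier K)"
      using ex1 closed by (intro inj_onI) metis
    show "(\<lambda>a. lincomb a B) ` (B \<rightarrow>\<^sub>E carrier K) = carrier V"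
      using ex1 closed by blast
  qed
  then have "card (carrier V) = card (B \<rightarrow>\<^sub>E carrier K)"
    by (metis bij_betw_same_card)
  then show ?thesis
    using B by (simp add: card_PiE dim_basis)
qed

locale finite_coord_space = field K for K (structure) +
  fixes n :: nat
  assumes finite_K: "finite (carrier K)"
begin

abbreviation "V \<equiv> coord_space K n"
abbreviation "q \<equiv> card (carrier K)"

definition subspaces :: "nat \<Rightarrow> (nat \<Rightarrow> 'a) set set" where
  "subspaces m = {W. VectorSpace.subspace K W V \<and> vectorspace.dim K (V\<lparr>carrier := W\<rparr>) = m}"

lemma V_simps:
  "carrier V = {..<n} \<rightarrow>\<^sub>E carrier K"
  "v \<oplus>\<^bsub>V\<^esub> w = (\<lambda>i\<in>{..<n}. v i \<oplus> w i)"
  "a \<odot>\<^bsub>V\<^esub> v = (\<lambda>i\<in>{..<n}. a \<otimes> v i)"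
  "\<zero>\<^bsub>V\<^esub> = (\<lambda>i\<in>{..<n}. \<zero>)"
  by (simp_all add: func_space_def)

sublocale V: vectorspace K V
  by (intro vectorspace.intro func_space_is_module field_axioms)

lemma q_ge_2: "2 \<le> q"
proof -
  have "card {\<zero>, \<one>} \<le> q" by (intro card_mono finite_K) auto
  then show ?thesis by simp
qed

lemma finite_V: "finite (carrier V)"
  by (simp add: V_simps(1) finite_PiE finite_K)

lemma card_V: "card (carrier V) = q ^ n"
  by (simp add: V_simps(1) card_PiE)

lemma submodule_carrier_subset: "VectorSpace.subspace K W V \<Longrightarrow> W \<subseteq> carrier V"
  using submodule.subset V.is_module by blast

lemma card_subspace:
  assumes "VectorSpace.subspace K W V"
  shows "card W = q ^ vectorspace.dim K (V\<lparr>carrier := W\<rparr>)"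
  using vectorspace.card_carrier_eq_power_dim[OF V.subspace_is_vs[OF assms]]
    finite_subset[OF submodule_carrier_subset[OF assms] finite_V] by simp

text \<open>Since \<open>q\<close> is at least 2, the power \<open>q ^ m\<close> determines
  \<open>m\<close>. Most later arguments can therefore use cardinality in place of
  dimension.\<close>

lemma subspaces_iff: "W \<in> subspaces m \<longleftrightarrow> submodule K W V \<and> card W = q ^ m"
proof (cases "submodule K W V")
  case True
  then have "VectorSpace.subspace K W V"
    by (simp add: VectorSpace.subspace_def V.vectorspace_axioms)
  then show ?thesis
    using q_ge_2 True by (simp add: subspaces_def card_subspace)
next
  case False
  then show ?thesis by (auto simp: subspaces_def)
qed

lemma finite_subspaces: "finite (subspaces m)"
  by (rule finite_subset[of _ "Pow (carrier V)"])
     (use submodule.subset in \<open>fastforce simp: finite_V subspaces_iff\<close>)+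

lemma flats_eq: "flats K n m = {v <+\<^bsub>V\<^esub> W | v W. v \<in> carrier V \<and> W \<in> subspaces m}"
  by (simp add: flats_def subspaces_def)

lemma flat_subset: "y \<in> flats K n m \<Longrightarrow> y \<subseteq> carrier V"
  by (auto simp: flats_eq subspaces_iff a_l_coset_def' dest!: submodule.subset)

lemma finite_flats: "finite (flats K n m)"
  by (rule finite_subset[of _ "Pow (carrier V)"]) (use flat_subset finite_V in auto)

lemma card_flat: "y \<in> flats K n m \<Longrightarrow> card y = q ^ m"
  by (auto simp: flats_eq subspaces_iff V.card_coset dest!: submodule.subset)

lemma card_flats_through_point:
  assumes "x \<in> carrier V"
  shows "card {y \<in> flats K n m. x \<in> y} = card (subspaces m)"
proof -
  have "{y \<in> flats K n m. x \<in> y}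
      = {v <+\<^bsub>V\<^esub> W | v W. v \<in> carrier V \<and> W \<in> subspaces m \<and> x \<in> v <+\<^bsub>V\<^esub> W}"
    by (auto simp: flats_eq)
  then show ?thesis
    using V.bij_betw_cosets_through_point[OF assms, of "subspaces m"]
    by (auto simp: subspaces_iff dest!: bij_betw_same_card)
qed

text \<open>The index set is a parameter because the form is needed on \<open>{..<m}\<close> for
  matrix rows, on \<open>{..<n}\<close> for hyperplanes, and on \<open>{..<n} - {i}\<close> when
  coordinate \<open>i\<close> is solved for.\<close>

definition dot :: "nat set \<Rightarrow> (nat \<Rightarrow> 'a) \<Rightarrow> (nat \<Rightarrow> 'a) \<Rightarrow> 'a" where
  "dot I c w = (\<Oplus>i\<in>I. c i \<otimes> w i)"

lemma dot_closed [simp]: "c \<in> I \<rightarrow> carrier K \<Longrightarrow> w \<in> I \<rightarrow> carrier K \<Longrightarrow> dot I c w \<in> carrier K"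
  unfolding dot_def by (intro finsum_closed) auto

lemma dot_cong:
  assumes "\<And>i. i \<in> I \<Longrightarrow> w i = w' i" "c \<in> I \<rightarrow> carrier K" "w' \<in> I \<rightarrow> carrier K"
  shows "dot I c w = dot I c w'"
  unfolding dot_def using assms by (intro finsum_cong') (auto simp: Pi_def)

lemma dot_commute:
  assumes "c \<in> I \<rightarrow> carrier K" "w \<in> I \<rightarrow> carrier K"
  shows "dot I c w = dot I w c"
  unfolding dot_def using assms by (intro finsum_cong') (auto simp: Pi_def m_comm)

lemma dot_zero:
  assumes "I \<subseteq> {..<n}" "c \<in> I \<rightarrow> carrier K"
  shows "dot I c \<zero>\<^bsub>V\<^esub> = \<zero>"
proof -
  have "dot I c \<zero>\<^bsub>V\<^esub> = (\<Oplus>i\<in>I. \<zero>)"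
    unfolding dot_def using assms by (intro finsum_cong') (auto simp: V_simps Pi_def subset_iff)
  then show ?thesis by simp
qed

lemma dot_add:
  assumes "I \<subseteq> {..<n}" "c \<in> I \<rightarrow> carrier K" "v \<in> carrier V" "w \<in> carrier V"
  shows "dot I c (v \<oplus>\<^bsub>V\<^esub> w) = dot I c v \<oplus> dot I c w"
proof -
  have *: "v i \<in> carrier K" "w i \<in> carrier K" "c i \<in> carrier K" "i < n" if "i \<in> I" for i
    using assms that by (auto simp: V_simps)
  have "dot I c (v \<oplus>\<^bsub>V\<^esub> w) = (\<Oplus>i\<in>I. c i \<otimes> v i \<oplus> c i \<otimes> w i)"
    unfolding dot_def by (intro finsum_cong') (auto simp: V_simps(2) r_distr *)
  also have "\<dots> = dot I c v \<oplus> dot I c w"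
    unfolding dot_def by (intro finsum_addf) (auto simp: *)
  finally show ?thesis .
qed

lemma dot_smult:
  assumes "I \<subseteq> {..<n}" "c \<in> I \<rightarrow> carrier K" "a \<in> carrier K" "v \<in> carrier V"
  shows "dot I c (a \<odot>\<^bsub>V\<^esub> v) = a \<otimes> dot I c v"
proof -
  have *: "v i \<in> carrier K" "c i \<in> carrier K" "i < n" if "i \<in> I" for i
    using assms that by (auto simp: V_simps)
  have fin: "finite I" using assms(1) finite_subset by blast
  have "dot I c (a \<odot>\<^bsub>V\<^esub> v) = (\<Oplus>i\<in>I. a \<otimes> (c i \<otimes> v i))"
    unfolding dot_def using assms(3) by (intro finsum_cong') (auto simp: V_simps(3) m_lcomm *)
  also have "\<dots> = a \<otimes> dot I c v"
    unfolding dot_def using assms(3) fin by (intro finsum_rdistr[symmetric]) (auto simp: *)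
  finally show ?thesis .
qed

lemma V_mem: "v \<in> carrier V \<Longrightarrow> i < n \<Longrightarrow> v i \<in> carrier K"
  using PiE_mem[of v "{..<n}" "\<lambda>_. carrier K" i] by (simp add: V_simps(1))

lemma V_ext:
  assumes "v \<in> carrier V" "w \<in> carrier V" "\<And>i. i < n \<Longrightarrow> v i = w i"
  shows "v = w"
  using PiE_ext[of v "{..<n}" "\<lambda>_. carrier K" w] assms by (simp add: V_simps(1))

lemma submoduleI:
  assumes "W \<subseteq> carrier V" "\<zero>\<^bsub>V\<^esub> \<in> W"
    and "\<And>v w. v \<in> W \<Longrightarrow> w \<in> W \<Longrightarrow> v \<oplus>\<^bsub>V\<^esub> w \<in> W"
    and "\<And>a v. a \<in> carrier K \<Longrightarrow> v \<in> W \<Longrightarrow> a \<odot>\<^bsub>V\<^esub> v \<in> W"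
  shows "submodule K W V"
  using assms V.module_axioms by (simp add: submodule_def)

subsection \<open>Counting subspaces\<close>

text \<open>The graph of the linear map from the first \<open>m\<close> coordinates to the remaining
  ones; the rows of its matrix are indexed by the target coordinates \<open>{m..<n}\<close>.\<close>

definition graph :: "nat \<Rightarrow> (nat \<Rightarrow> nat \<Rightarrow> 'a) \<Rightarrow> (nat \<Rightarrow> 'a) set" where
  "graph m A = {w \<in> carrier V. \<forall>j\<in>{m..<n}. w j = dot {..<m} (A j) w}"

text \<open>The point of the graph above \<open>u\<close>, that is, the inverse of the projection to
  the first \<open>m\<close> coordinates.\<close>

definition graph_point :: "nat \<Rightarrow> (nat \<Rightarrow> nat \<Rightarrow> 'a) \<Rightarrow> (nat \<Rightarrow> 'a) \<Rightarrow> nat \<Rightarrow> 'a" where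
  "graph_point m A u = (\<lambda>j\<in>{..<n}. if j < m then u j else dot {..<m} (A j) u)"

abbreviation "matrices m \<equiv> {m..<n} \<rightarrow>\<^sub>E ({..<m} \<rightarrow>\<^sub>E carrier K)"

lemma graph_point_in_graph:
  assumes m: "m \<le> n" and A: "A \<in> matrices m" and u: "u \<in> {..<m} \<rightarrow>\<^sub>E carrier K"
  shows "graph_point m A u \<in> graph m A"
proof -
  have Aj: "A j \<in> {..<m} \<rightarrow> carrier K" if "j \<in> {m..<n}" for j
    using that A by fastforce
  have u': "u \<in> {..<m} \<rightarrow> carrier K" using u by auto
  have "dot {..<m} (A j) (graph_point m A u) = dot {..<m} (A j) u" if "j \<in> {m..<n}" for j
    using m u' by (intro dot_cong Aj that) (auto simp: graph_point_def)
  moreover have "graph_point m A u \<in> carrier V"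
    using u' by (auto simp: V_simps(1) graph_point_def intro!: dot_closed Aj)
  ultimately show ?thesis
    by (auto simp: graph_def graph_point_def)
qed

lemma graph_submodule:
  assumes m: "m \<le> n" and A: "A \<in> matrices m"
  shows "submodule K (graph m A) V"
proof -
  have Aj: "A j \<in> {..<m} \<rightarrow> carrier K" if "j \<in> {m..<n}" for j
    using that A by fastforce
  have sub: "{..<m} \<subseteq> {..<n}" using m by auto
  \<comment> \<open>Linearity of \<open>dot\<close> is applied first, while the operations of
    \<open>V\<close> are still folded; only afterwards are they expanded into coordinates.\<close>
  note simps = dot_add[OF sub Aj] dot_smult[OF sub Aj] dot_zero[OF sub Aj]
  show ?thesis
  proof (rule submoduleI)
    show "graph m A \<subseteq> carrier V" by (auto simp: graph_def)
    show "\<zero>\<^bsub>V\<^esub> \<in> graph m A"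
      unfolding graph_def by (simp add: simps del: V_simps(4)) (simp add: V_simps(4))
    show "v \<oplus>\<^bsub>V\<^esub> w \<in> graph m A" if "v \<in> graph m A" "w \<in> graph m A" for v w
      using that unfolding graph_def by (simp add: simps) (simp add: V_simps(2))
    show "a \<odot>\<^bsub>V\<^esub> v \<in> graph m A" if "a \<in> carrier K" "v \<in> graph m A" for a v
      using that unfolding graph_def by (simp add: simps) (simp add: V_simps(3))
  qed
qed

text \<open>The projection to the first \<open>m\<close> coordinates is a bijection on the graph,
  with inverse \<open>graph_point m A\<close>.\<close>

lemma card_graph:
  assumes m: "m \<le> n" and A: "A \<in> matrices m"
  shows "card (graph m A) = q ^ m"
proof -
  have Aj: "A j \<in> {..<m} \<rightarrow> carrier K" if "j \<in> {m..<n}" for j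
    using that A by fastforce
  have "bij_betw (\<lambda>w. restrict w {..<m}) (graph m A) ({..<m} \<rightarrow>\<^sub>E carrier K)"
  proof (rule bij_betwI[where g = "graph_point m A"])
    show "(\<lambda>w. restrict w {..<m}) \<in> graph m A \<rightarrow> {..<m} \<rightarrow>\<^sub>E carrier K"
      using m by (auto simp: graph_def V_simps(1))
    show "graph_point m A \<in> ({..<m} \<rightarrow>\<^sub>E carrier K) \<rightarrow> graph m A"
      using graph_point_in_graph[OF assms] by auto
    show "graph_point m A (restrict w {..<m}) = w" if "w \<in> graph m A" for w
    proof
      fix j
      have w: "w \<in> {..<n} \<rightarrow>\<^sub>E carrier K" "\<And>j. j \<in> {m..<n} \<Longrightarrow> w j = dot {..<m} (A j) w"
        using that by (auto simp: graph_def V_simps(1))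
      have w': "w \<in> {..<m} \<rightarrow> carrier K" using m by (intro Pi_I PiE_mem[OF w(1)]) auto
      have "dot {..<m} (A j) (restrict w {..<m}) = dot {..<m} (A j) w" if "j \<in> {m..<n}" for j
        using w' by (intro dot_cong Aj[OF that]) simp_all
      then show "graph_point m A (restrict w {..<m}) j = w j"
        using w by (cases "j < n") (auto simp: graph_point_def)
    qed
    show "restrict (graph_point m A u) {..<m} = u" if "u \<in> {..<m} \<rightarrow>\<^sub>E carrier K" for u
      using that m by (auto simp: graph_point_def fun_eq_iff PiE_def extensional_def)
  qed
  then show ?thesis
    by (simp add: bij_betw_same_card card_PiE)
qed

text \<open>The entry \<open>A j i\<close> can be read off the graph: it is coordinate
  \<open>j\<close> of the point above the \<open>i\<close>-th unit vector \<open>e\<close>.\<close>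

lemma inj_on_graph:
  assumes m: "m \<le> n"
  shows "inj_on (graph m) (matrices m)"
proof (rule inj_onI)
  fix A A' assume A: "A \<in> matrices m" "A' \<in> matrices m" and eq: "graph m A = graph m A'"
  have Aj: "C j \<in> {..<m} \<rightarrow> carrier K" if "j \<in> {m..<n}" "C \<in> matrices m" for j C
    using that by fastforce
  have "A j i = A' j i" if j: "j \<in> {m..<n}" and i: "i < m" for i j
  proof -
    define e where "e = (\<lambda>k\<in>{..<m}. if k = i then \<one> else \<zero>)"
    have e: "e \<in> {..<m} \<rightarrow>\<^sub>E carrier K" by (auto simp: e_def)
    have dot_e: "dot {..<m} c e = c i" if c: "c \<in> {..<m} \<rightarrow> carrier K" for c
    proof -
      have "dot {..<m} c e = (\<Oplus>k\<in>{..<m}. if i = k then c k else \<zero>)"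
        unfolding dot_def using c by (intro finsum_cong') (auto simp: e_def Pi_def)
      also have "\<dots> = c i" using i c by (intro finsum_singleton) auto
      finally show ?thesis .
    qed
    have "graph_point m A e \<in> graph m A'"
      using graph_point_in_graph[OF m A(1) e] eq by simp
    then have "graph_point m A e j = dot {..<m} (A' j) (graph_point m A e)"
      using j by (simp add: graph_def)
    also have "\<dots> = dot {..<m} (A' j) e"
      using m by (intro dot_cong Aj[OF j A(2)]) (simp_all add: graph_point_def e_def)
    finally show ?thesis
      using j by (simp add: graph_point_def dot_e Aj A)
  qed
  then show "A = A'"
    by (intro PiE_ext[OF A] PiE_ext[OF PiE_mem[OF A(1)] PiE_mem[OF A(2)]]) simp_all
qed

text \<open>Graphs are only some of the subspaces, but there is one for each matrix with
  \<open>n - m\<close> rows and \<open>m\<close> columns, which already gives the order of magnitude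
  needed.\<close>

lemma card_subspaces_ge:
  assumes "m \<le> n"
  shows "q ^ (m * (n - m)) \<le> card (subspaces m)"
proof -
  have "q ^ (m * (n - m)) = card (matrices m)"
    by (simp add: card_PiE power_mult)
  also have "\<dots> = card (graph m ` matrices m)"
    by (simp add: card_image inj_on_graph assms)
  also have "\<dots> \<le> card (subspaces m)"
    using assms by (intro card_mono finite_subspaces)
      (auto simp: subspaces_iff graph_submodule card_graph)
  finally show ?thesis .
qed

section \<open>Upper bounds for the numbers of lines and hyperplanes through the origin\<close>

lemma nonzero_coordinate:
  assumes "v \<in> carrier V" "v \<noteq> \<zero>\<^bsub>V\<^esub>"
  obtains i where "i < n" "v i \<noteq> \<zero>"
  \<comment> \<open>Outside \<open>{..<n}\<close> all elements of \<open>V\<close> take the value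
    \<open>undefined\<close>, so two of them can differ only at an index below
    \<open>n\<close>.\<close>
  using assms by (auto simp: V_simps(1,4) fun_eq_iff PiE_def extensional_def split: if_splits)

lemma inj_on_smult:
  assumes v: "v \<in> carrier V" "v \<noteq> \<zero>\<^bsub>V\<^esub>"
  shows "inj_on (\<lambda>a. a \<odot>\<^bsub>V\<^esub> v) (carrier K)"
proof (rule inj_onI)
  fix a b assume ab: "a \<in> carrier K" "b \<in> carrier K" and eq: "a \<odot>\<^bsub>V\<^esub> v = b \<odot>\<^bsub>V\<^esub> v"
  obtain i where i: "i < n" "v i \<noteq> \<zero>" using nonzero_coordinate[OF v] .
  have "a \<otimes> v i = b \<otimes> v i"
    using fun_cong[OF eq, of i] i by (simp add: V_simps(3))
  then show "a = b"
    using ab i V_mem[OF v(1) i(1)] by (simp add: m_rcancel)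
qed

text \<open>Distinct lines through the origin meet only in zero, so their sets of
  \<open>q - 1\<close> nonzero vectors are disjoint.\<close>

lemma card_subspaces_1_le: "card (subspaces 1) * (q - 1) \<le> q ^ n"
  unfolding card_V[symmetric]
proof (rule card_mult_le_card_of_disjoint_family[where C = "\<lambda>W. W - {\<zero>\<^bsub>V\<^esub>}"])
  fix W assume "W \<in> subspaces 1"
  then have W: "submodule K W V" "card W = q" by (auto simp: subspaces_iff)
  have fin: "finite W" using W(2) q_ge_2 card.infinite by force
  show "W - {\<zero>\<^bsub>V\<^esub>} \<subseteq> carrier V" using submodule.subset[OF W(1)] by blast
  show "q - 1 \<le> card (W - {\<zero>\<^bsub>V\<^esub>})"
    using W fin by (simp add: submodule.zero_closed)
  \<comment> \<open>The \<open>q\<close> multiples of a nonzero vector are distinct and therefore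
    fill the line.\<close>
  have W_eq: "W = (\<lambda>a. a \<odot>\<^bsub>V\<^esub> v) ` carrier K" if v: "v \<in> W" "v \<noteq> \<zero>\<^bsub>V\<^esub>" for v
  proof (rule card_subset_eq[symmetric, OF fin])
    show "(\<lambda>a. a \<odot>\<^bsub>V\<^esub> v) ` carrier K \<subseteq> W"
      using v submodule.smult_closed[OF W(1)] by blast
    show "card ((\<lambda>a. a \<odot>\<^bsub>V\<^esub> v) ` carrier K) = card W"
      using v W(2) submodule.subset[OF W(1)] by (subst card_image[OF inj_on_smult]) auto
  qed
  fix W' assume "W' \<in> subspaces 1"
  then have W': "submodule K W' V" "card W' = q" by (auto simp: subspaces_iff)
  have fin': "finite W'" using W'(2) q_ge_2 card.infinite by force
  have "W = W'" if v: "v \<in> W" "v \<in> W'" "v \<noteq> \<zero>\<^bsub>V\<^esub>" for v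
  proof (rule card_subset_eq[OF fin'])
    show "W \<subseteq> W'"
      using W_eq[OF v(1,3)] v(2) submodule.smult_closed[OF W'(1)] by blast
  qed (simp add: W W')
  then show "(W - {\<zero>\<^bsub>V\<^esub>}) \<inter> (W' - {\<zero>\<^bsub>V\<^esub>}) = {}" if "W \<noteq> W'"
    using that by blast
qed (simp_all add: finite_V finite_subspaces)

text \<open>For \<open>c\<close> zero this is the whole space, which is why the size bound below
  excludes that case.\<close>

definition hyperplane :: "(nat \<Rightarrow> 'a) \<Rightarrow> (nat \<Rightarrow> 'a) set" where
  "hyperplane c = {w \<in> carrier V. dot {..<n} c w = \<zero>}"

lemma V_Pi: "v \<in> carrier V \<Longrightarrow> v \<in> {..<n} \<rightarrow> carrier K"
  by (auto intro: V_mem)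

lemma hyperplane_submodule:
  assumes "c \<in> carrier V"
  shows "submodule K (hyperplane c) V"
  using V_Pi[OF assms]
  by (intro submoduleI) (auto simp: hyperplane_def dot_add dot_smult dot_zero)

text \<open>At an index \<open>i\<close> with \<open>c i\<close> nonzero the equation determines
  \<open>w i\<close> from the other coordinates, so forgetting coordinate \<open>i\<close> is
  injective on the hyperplane.\<close>

lemma card_hyperplane_le:
  assumes c: "c \<in> carrier V" "c \<noteq> \<zero>\<^bsub>V\<^esub>"
  shows "card (hyperplane c) \<le> q ^ (n - 1)"
proof -
  obtain i where i: "i < n" "c i \<noteq> \<zero>" using nonzero_coordinate[OF c] .
  define J where "J = {..<n} - {i}"
  have split: "dot {..<n} c w = c i \<otimes> w i \<oplus> dot J c w" if "w \<in> carrier V" for w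
  proof -
    have eq: "{..<n} = insert i J" using i by (auto simp: J_def)
    have "(\<lambda>k. c k \<otimes> w k) \<in> J \<rightarrow> carrier K" "c i \<otimes> w i \<in> carrier K" "finite J" "i \<notin> J"
      using V_mem[OF c(1)] V_mem[OF that] i by (simp_all add: J_def)
    then show ?thesis
      unfolding dot_def eq by (intro finsum_insert)
  qed
  have "inj_on (\<lambda>w. restrict w J) (hyperplane c)"
  proof (rule inj_onI)
    fix v w assume vw: "v \<in> hyperplane c" "w \<in> hyperplane c" and eq: "restrict v J = restrict w J"
    have V: "v \<in> carrier V" "w \<in> carrier V" using vw by (auto simp: hyperplane_def)
    have eqJ: "v j = w j" if "j \<in> J" for j using fun_cong[OF eq, of j] that by simp
    have P: "c \<in> J \<rightarrow> carrier K" "w \<in> J \<rightarrow> carrier K" "c i \<in> carrier K" "v i \<in> carrier K"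
      "w i \<in> carrier K"
      using V c i by (auto simp: J_def V_mem)
    have "dot J c v = dot J c w" using eqJ P by (intro dot_cong) auto
    moreover have "c i \<otimes> v i \<oplus> dot J c v = c i \<otimes> w i \<oplus> dot J c w"
      using vw V by (simp add: hyperplane_def flip: split)
    ultimately have "c i \<otimes> v i = c i \<otimes> w i"
      using P by simp
    then have "v i = w i" using P i by (simp add: m_lcancel)
    with eqJ show "v = w"
      by (intro V_ext V) (auto simp: J_def)
  qed
  then have "card (hyperplane c) = card ((\<lambda>w. restrict w J) ` hyperplane c)"
    by (simp add: card_image)
  also have "\<dots> \<le> card (J \<rightarrow>\<^sub>E carrier K)"
    by (intro card_mono finite_PiE image_subsetI)
      (simp_all add: J_def finite_K hyperplane_def restrict_PiE_iff V_mem)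
  also have "\<dots> = q ^ (n - 1)"
    using i by (simp add: J_def card_PiE)
  finally show ?thesis .
qed

lemma ex_hyperplane_superset:
  assumes W: "W \<in> subspaces (n - 1)" and n: "0 < n"
  obtains c where "c \<in> carrier V" "c \<noteq> \<zero>\<^bsub>V\<^esub>" "W \<subseteq> hyperplane c"
proof -
  have sub: "VectorSpace.subspace K W V" and dim: "vectorspace.dim K (V\<lparr>carrier := W\<rparr>) = n - 1"
    using W by (auto simp: subspaces_def)
  interpret W: vectorspace K "V\<lparr>carrier := W\<rparr>" by (rule V.subspace_is_vs[OF sub])
  have WV: "W \<subseteq> carrier V" by (rule submodule_carrier_subset[OF sub])
  obtain B where B: "finite B" "W.basis B"
    using W.finite_basis_exists[OF W.fin_dim_of_finite] finite_subset[OF WV finite_V] by auto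
  have BW: "B \<subseteq> W" "W.span B = W" using B(2) by (auto simp: W.basis_def)
  \<comment> \<open>The basis was taken inside \<open>W\<close>; its span is the same when formed in
    \<open>V\<close>, where the hyperplane is a submodule.\<close>
  have span: "V.span B = W"
    using V.span_li_not_depend(1)[OF BW(1) V.is_module[OF sub]] BW(2) by simp
  have cardB: "card B = n - 1" using W.dim_basis[OF B] dim by simp
  define f where "f = (\<lambda>c. \<lambda>b\<in>B. dot {..<n} b c)"
  \<comment> \<open>Pigeonhole replaces duality: two vectors agree under all \<open>n - 1\<close> functionals given by \<open>B\<close>, and
    their difference is the normal vector.\<close>
  have "\<not> inj_on f (carrier V)"
  proof
    assume "inj_on f (carrier V)"
    moreover have "f ` carrier V \<subseteq> B \<rightarrow>\<^sub>E carrier K"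
      using BW(1) WV V_Pi by (auto simp: f_def intro!: dot_closed)
    ultimately have "card (carrier V) \<le> card (B \<rightarrow>\<^sub>E carrier K)"
      using B(1) finite_K by (intro card_inj_on_le finite_PiE) auto
    then have "q ^ n \<le> q ^ (n - 1)" using B(1) cardB by (simp add: card_V card_PiE)
    then show False using q_ge_2 n by simp
  qed
  then obtain c d where cd: "c \<in> carrier V" "d \<in> carrier V" "f c = f d" "c \<noteq> d"
    by (auto simp: inj_on_def)
  \<comment> \<open>The difference is written with the scalar \<open>\<ominus> \<one>\<close> so
    that \<open>dot_add\<close> and \<open>dot_smult\<close> apply to it.\<close>
  define g where "g = c \<oplus>\<^bsub>V\<^esub> (\<ominus> \<one>) \<odot>\<^bsub>V\<^esub> d"
  have gV: "g \<in> carrier V" using cd by (simp add: g_def)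
  have "g = c \<ominus>\<^bsub>V\<^esub> d" using cd by (simp add: g_def V.smult_minus_1 a_minus_def)
  then have g0: "g \<noteq> \<zero>\<^bsub>V\<^esub>" using cd by simp
  have "b \<in> hyperplane g" if "b \<in> B" for b
  proof -
    have bV: "b \<in> carrier V" using that BW WV by blast
    have eq: "dot {..<n} b c = dot {..<n} b d"
      using fun_cong[OF cd(3), of b] that by (simp add: f_def)
    \<comment> \<open>Linearity of \<open>dot\<close> was shown in its second argument, so the
      normal vector is moved there.\<close>
    have "dot {..<n} g b = dot {..<n} b g"
      by (intro dot_commute V_Pi gV bV)
    also have "\<dots> = dot {..<n} b c \<oplus> \<ominus> \<one> \<otimes> dot {..<n} b d"
      using cd V_Pi[OF bV] by (simp add: g_def dot_add dot_smult)
    also have "\<dots> = \<zero>"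
      using V_Pi[OF bV] V_Pi[OF cd(2)] by (simp add: eq l_minus r_neg)
    finally show ?thesis using bV by (simp add: hyperplane_def)
  qed
  then have "V.span B \<subseteq> hyperplane g"
    by (intro V.span_is_subset hyperplane_submodule gV) auto
  then show thesis using that gV g0 span by blast
qed

text \<open>\<open>W\<close> already has \<open>q ^ (n - 1)\<close> elements, the most that the
  hyperplane can have. A normal vector thus determines its hyperplane.\<close>

lemma hyperplane_eq:
  assumes "W \<in> subspaces (n - 1)" "c \<in> carrier V" "c \<noteq> \<zero>\<^bsub>V\<^esub>" "W \<subseteq> hyperplane c"
  shows "W = hyperplane c"
proof (rule card_seteq)
  show "finite (hyperplane c)"
    using finite_V by (simp add: hyperplane_def)
  show "card (hyperplane c) \<le> card W"
    using card_hyperplane_le assms by (simp add: subspaces_iff)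
qed fact

text \<open>Each hyperplane has at least \<open>q - 1\<close> normal vectors, and distinct hyperplanes share none.\<close>

lemma card_hyperplanes_le:
  assumes n: "0 < n"
  shows "card (subspaces (n - 1)) * (q - 1) \<le> q ^ n"
  unfolding card_V[symmetric]
proof (rule card_mult_le_card_of_disjoint_family
    [where C = "\<lambda>W. {c \<in> carrier V. c \<noteq> \<zero>\<^bsub>V\<^esub> \<and> W \<subseteq> hyperplane c}"])
  fix W assume W: "W \<in> subspaces (n - 1)"
  obtain c where c: "c \<in> carrier V" "c \<noteq> \<zero>\<^bsub>V\<^esub>" "W \<subseteq> hyperplane c"
    using ex_hyperplane_superset[OF W n] .
  have inj: "inj_on (\<lambda>a. a \<odot>\<^bsub>V\<^esub> c) (carrier K)" by (rule inj_on_smult[OF c(1,2)])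
  \<comment> \<open>The nonzero multiples of one normal vector supply the required
    \<open>q - 1\<close> normal vectors.\<close>
  have "a \<odot>\<^bsub>V\<^esub> c \<in> {c \<in> carrier V. c \<noteq> \<zero>\<^bsub>V\<^esub> \<and> W \<subseteq> hyperplane c}" if a: "a \<in> carrier K - {\<zero>}" for a
  proof -
    have "a \<odot>\<^bsub>V\<^esub> c \<noteq> \<zero> \<odot>\<^bsub>V\<^esub> c" using a inj_onD[OF inj, of a \<zero>] by auto
    then have "a \<odot>\<^bsub>V\<^esub> c \<noteq> \<zero>\<^bsub>V\<^esub>" using c by simp
    moreover have "w \<in> hyperplane (a \<odot>\<^bsub>V\<^esub> c)" if "w \<in> W" for w
    proof -
      have w: "w \<in> carrier V" "dot {..<n} c w = \<zero>" using that c by (auto simp: hyperplane_def)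
      have "dot {..<n} (a \<odot>\<^bsub>V\<^esub> c) w = dot {..<n} w (a \<odot>\<^bsub>V\<^esub> c)"
        using a c w by (intro dot_commute V_Pi) auto
      also have "\<dots> = a \<otimes> dot {..<n} w c"
        using a c w V_Pi[OF w(1)] by (intro dot_smult) auto
      also have "dot {..<n} w c = \<zero>"
        using w c by (subst dot_commute) (auto simp: V_Pi)
      finally show ?thesis using w a by (simp add: hyperplane_def)
    qed
    ultimately show ?thesis using a c by auto
  qed
  then have "card ((\<lambda>a. a \<odot>\<^bsub>V\<^esub> c) ` (carrier K - {\<zero>}))
      \<le> card {c \<in> carrier V. c \<noteq> \<zero>\<^bsub>V\<^esub> \<and> W \<subseteq> hyperplane c}"
    using finite_V by (intro card_mono) auto
  also have "card ((\<lambda>a. a \<odot>\<^bsub>V\<^esub> c) ` (carrier K - {\<zero>})) = card (carrier K - {\<zero>})"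
    by (intro card_image inj_on_subset[OF inj]) auto
  also have "\<dots> = q - 1"
    using finite_K by simp
  finally show "q - 1 \<le> card {c \<in> carrier V. c \<noteq> \<zero>\<^bsub>V\<^esub> \<and> W \<subseteq> hyperplane c}" .
next
  fix W W' assume W: "W \<in> subspaces (n - 1)" "W' \<in> subspaces (n - 1)" "W \<noteq> W'"
  then show "{c \<in> carrier V. c \<noteq> \<zero>\<^bsub>V\<^esub> \<and> W \<subseteq> hyperplane c} \<inter>
      {c \<in> carrier V. c \<noteq> \<zero>\<^bsub>V\<^esub> \<and> W' \<subseteq> hyperplane c} = {}"
    using hyperplane_eq[OF W(1)] hyperplane_eq[OF W(2)] by blast
qed (auto simp: finite_V finite_subspaces)

subsection \<open>Incidences of points and flats\<close>

text \<open>The edge set of the biregular bipartite graph to which the probabilistic bounds are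
  applied.\<close>

definition incidences :: "nat \<Rightarrow> ((nat \<Rightarrow> 'a) \<times> (nat \<Rightarrow> 'a) set) set" where
  "incidences m = (SIGMA x:carrier V. {y \<in> flats K n m. x \<in> y})"

lemma incidences_subset: "incidences m \<subseteq> carrier V \<times> flats K n m"
  by (auto simp: incidences_def)

lemma card_incidences: "card (incidences m) = q ^ n * card (subspaces m)"
  by (simp add: incidences_def card_SigmaI finite_V finite_flats card_flats_through_point card_V)

lemma card_points_on_flat: "y \<in> flats K n m \<Longrightarrow> card {x. (x, y) \<in> incidences m} = q ^ m"
proof -
  assume y: "y \<in> flats K n m"
  then have "{x. (x, y) \<in> incidences m} = y"
    using flat_subset by (auto simp: incidences_def)
  then show ?thesis using card_flat[OF y] by simp
qed

lemma card_flats_on_point: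
  "x \<in> carrier V \<Longrightarrow> card {y. (x, y) \<in> incidences m} = card (subspaces m)"
  using card_flats_through_point[of x m] by (simp add: incidences_def)

text \<open>Double counting of incidences: \<open>q ^ m\<close> points on each flat against
  \<open>card (subspaces m)\<close> flats through each point.\<close>

lemma card_flats_mult: "card (flats K n m) * q ^ m = q ^ n * card (subspaces m)"
proof -
  have "prod.swap ` incidences m = (SIGMA y:flats K n m. {x. (x, y) \<in> incidences m})"
    by (auto simp: incidences_def)
  then have "card (incidences m) = card (SIGMA y:flats K n m. {x. (x, y) \<in> incidences m})"
    using card_image[OF inj_on_subset[OF inj_swap subset_UNIV], of "incidences m"] by metis
  also have "\<dots> = card (flats K n m) * q ^ m"
    using finite_flats finite_subset[OF _ finite_V]
    by (subst card_SigmaI) (auto simp: card_points_on_flat, auto simp: incidences_def)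
  finally show ?thesis by (simp add: card_incidences)
qed

text \<open>Each point lies on at least \<open>q ^ m\<close> flats, because
  \<open>m * (n - m)\<close> is at least \<open>m\<close>. This makes the error term for flats no
  larger than the one for points.\<close>

lemma card_flats_ge:
  assumes "m < n"
  shows "q ^ n \<le> card (flats K n m)"
proof -
  have "q ^ n * q ^ m \<le> q ^ n * q ^ (m * (n - m))"
    using assms q_ge_2 by (intro mult_left_mono power_increasing) auto
  also have "\<dots> \<le> card (flats K n m) * q ^ m"
    unfolding card_flats_mult using assms by (intro mult_left_mono card_subspaces_ge) auto
  finally show ?thesis
    using q_ge_2 by simp
qed

section \<open>Bounds on the incidence probability for a fixed field and density\<close>

context
  fixes p :: real assumes p: "0 \<le> p" "p \<le> 1"
begin

interpretation random_pair "carrier V" "flats K n m" p for m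
  using finite_V finite_flats p by unfold_locales

text \<open>The two events differ only off the support: almost surely \<open>X\<close> consists of
  points and \<open>Y\<close> of flats, and then membership is the same as being an edge.\<close>

lemma incidence_prob_eq:
  "incidence_prob K n m p =
     measure_pmf.prob (pair m) {(X, Y). \<exists>x\<in>X. \<exists>y\<in>Y. (x, y) \<in> incidences m}"
proof -
  have "set_pmf (pair m) \<subseteq> Pow (carrier V) \<times> Pow (flats K n m)"
    by (auto simp: pair_def random_subset_def)
  then have eq: "{(X, Y). \<exists>x\<in>X. \<exists>y\<in>Y. x \<in> y} \<inter> set_pmf (pair m)
      = {(X, Y). \<exists>x\<in>X. \<exists>y\<in>Y. (x, y) \<in> incidences m} \<inter> set_pmf (pair m)"
    unfolding incidences_def by fast
  have "incidence_prob K n m p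
      = measure_pmf.prob (pair m) ({(X, Y). \<exists>x\<in>X. \<exists>y\<in>Y. x \<in> y} \<inter> set_pmf (pair m))"
    by (simp only: incidence_prob_def pair_def measure_Int_set_pmf)
  then show ?thesis
    by (simp only: eq measure_Int_set_pmf)
qed

lemma incidence_prob_le_incidences: "incidence_prob K n m p \<le> p\<^sup>2 * (real q ^ n * card (subspaces m))"
  using prob_edge_le_card_edges[OF incidences_subset[of m]]
  by (simp add: incidence_prob_eq card_incidences)

lemma incidence_prob_le_points: "incidence_prob K n m p \<le> p * real q ^ n"
  using prob_edge_le_card_left[OF incidences_subset[of m]]
  by (simp add: incidence_prob_eq card_V)

text \<open>The error terms for points and for flats are merged into one with numerator 2, by
  \<open>card_flats_ge\<close>.\<close>

lemma incidence_prob_ge: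
  assumes "0 < p" "m < n"
  shows "1 - (1 / (p\<^sup>2 * (real q ^ n * card (subspaces m))) + 2 / (p * real q ^ n))
       \<le> incidence_prob K n m p"
proof -
  have "0 < q ^ (m * (n - m))" using q_ge_2 by simp
  also have "\<dots> \<le> card (subspaces m)" using assms by (intro card_subspaces_ge) auto
  finally have "0 < card (incidences m)" using q_ge_2 by (simp add: card_incidences)
  then have "incidences m \<noteq> {}" by auto
  have "real q ^ n \<le> real (card (flats K n m))"
    using card_flats_ge[OF assms(2)] by (metis of_nat_le_iff of_nat_power)
  moreover have "0 < p * real q ^ n" using assms q_ge_2 by simp
  ultimately have "1 / (p * real (card (flats K n m))) \<le> 1 / (p * real q ^ n)"
    using assms(1) by (intro frac_le mult_left_mono) simp_all
  with prob_edge_ge[OF incidences_subset \<open>incidences m \<noteq> {}\<close> assms(1)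
      card_flats_on_point card_points_on_flat]
  show ?thesis
    by (simp add: incidence_prob_eq card_incidences card_V)
qed

end

section \<open>The threshold function and the probability bounds in terms of the ratio of density to
  threshold\<close>

definition threshold :: "nat \<Rightarrow> real" where
  "threshold m = (if m \<in> {1, n - 1}
     then real q powr (- (1/2) * ((real n - real m) * (real m + 1) + real m))
     else real q powr (- real n))"

lemma threshold_pos: "0 < threshold m"
  using q_ge_2 by (simp add: threshold_def)

context
  fixes m :: nat assumes m: "1 \<le> m" "m < n"
begin

text \<open>For \<open>m = 1\<close> and for \<open>m = n - 1\<close> the exponent
  \<open>(n - m) * (m + 1) + m\<close> equals \<open>2 * n - 1\<close>, so the squared threshold is
  the reciprocal of the order of the number of incidences.\<close>

lemma threshold_power2:
  assumes "m \<in> {1, n - 1}"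
  shows "(threshold m)\<^sup>2 * (real q ^ n * real q ^ (n - 1)) = 1"
proof -
  have "(real n - real m) * (real m + 1) + real m = 2 * real n - 1"
    using assms m by (auto simp: of_nat_diff algebra_simps)
  then have "threshold m = real q powr (- (1/2) * (2 * real n - 1))"
    using assms by (simp add: threshold_def)
  then have "(threshold m)\<^sup>2 = real q powr (1 - 2 * real n)"
    using q_ge_2 by (simp add: power2_eq_square flip: powr_add)
  moreover have "real q ^ n * real q ^ (n - 1) = real q powr (2 * real n - 1)"
    using q_ge_2 m by (simp add: of_nat_diff algebra_simps flip: powr_realpow powr_add)
  ultimately show ?thesis
    using q_ge_2 by (simp flip: powr_add)
qed

text \<open>The factor 2 absorbs the quotient of \<open>q\<close> by \<open>q - 1\<close>, which is
  at most 2 because \<open>q\<close> is at least 2.\<close>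

lemma card_subspaces_le:
  assumes "m \<in> {1, n - 1}"
  shows "card (subspaces m) \<le> 2 * q ^ (n - 1)"
proof -
  have "card (subspaces m) * (q - 1) \<le> q ^ n"
    using assms m card_subspaces_1_le card_hyperplanes_le by auto
  also have "\<dots> = q * q ^ (n - 1)"
    using m by (metis less_zeroE not_gr_zero power_eq_if)
  also have "\<dots> \<le> (2 * (q - 1)) * q ^ (n - 1)"
    using q_ge_2 by (intro mult_right_mono) auto
  finally have "card (subspaces m) * (q - 1) \<le> (2 * q ^ (n - 1)) * (q - 1)"
    by (simp add: mult_ac)
  then show ?thesis using q_ge_2 by simp
qed

text \<open>For lines and hyperplanes the square of the right-hand side is \<open>q\<close>; in the
  other case the right-hand side is exactly 1.\<close>

lemma threshold_mult_points_ge: "1 \<le> threshold m * real q ^ n"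
proof (cases "m \<in> {1, n - 1}")
  case True
  have "1 = (threshold m)\<^sup>2 * (real q ^ n * real q ^ (n - 1))"
    by (rule threshold_power2[OF True, symmetric])
  also have "\<dots> \<le> (threshold m)\<^sup>2 * (real q ^ n * real q ^ n)"
    using q_ge_2 by (intro mult_left_mono power_increasing) auto
  also have "\<dots> = (threshold m * real q ^ n)\<^sup>2"
    by (simp add: power2_eq_square mult_ac)
  finally show ?thesis
    using threshold_pos[of m] by (auto intro: power2_le_imp_le)
next
  case False
  then show ?thesis
    using q_ge_2 by (simp add: threshold_def powr_minus powr_realpow)
qed

text \<open>It comes down to the exponent in \<open>card_subspaces_ge\<close>:
  \<open>m * (n - m)\<close> is \<open>n - 1\<close> for lines and hyperplanes and at least
  \<open>n\<close> otherwise.\<close>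

lemma threshold_mult_incidences_ge:
  "1 \<le> (threshold m)\<^sup>2 * (real q ^ n * card (subspaces m))"
proof (cases "m \<in> {1, n - 1}")
  case True
  have "n - 1 \<le> m * (n - m)" using True m by auto
  then have "q ^ (n - 1) \<le> q ^ (m * (n - m))"
    using q_ge_2 by (intro power_increasing) auto
  also have "\<dots> \<le> card (subspaces m)" using m by (intro card_subspaces_ge) auto
  finally have "real q ^ (n - 1) \<le> card (subspaces m)"
    by (metis of_nat_le_iff of_nat_power)
  then have "(threshold m)\<^sup>2 * (real q ^ n * real q ^ (n - 1))
      \<le> (threshold m)\<^sup>2 * (real q ^ n * card (subspaces m))"
    by (intro mult_left_mono) auto
  then show ?thesis by (simp only: threshold_power2[OF True])
next
  case False
  then have "2 \<le> m" "m + 2 \<le> n" using m by auto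
  \<comment> \<open>In these terms \<open>m * (n - m)\<close> is \<open>(2 + a) * (2 + b)\<close>,
    which is at least \<open>4 + a + b = n\<close>.\<close>
  then obtain a b where "m = 2 + a" "n = m + 2 + b" by (metis le_Suc_ex)
  then have "n \<le> m * (n - m)" by (simp add: algebra_simps)
  then have "q ^ n \<le> q ^ (m * (n - m))"
    using q_ge_2 by (intro power_increasing) auto
  also have "\<dots> \<le> card (subspaces m)" using m by (intro card_subspaces_ge) auto
  finally have "real q ^ n \<le> card (subspaces m)"
    by (metis of_nat_le_iff of_nat_power)
  then have "(threshold m)\<^sup>2 * (real q ^ n * real q ^ n)
      \<le> (threshold m)\<^sup>2 * (real q ^ n * card (subspaces m))"
    by (intro mult_left_mono) auto
  moreover have "1 \<le> (threshold m * real q ^ n) * (threshold m * real q ^ n)"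
    using threshold_mult_points_ge mult_mono[of 1 _ 1] by fastforce
  ultimately show ?thesis by (simp add: power2_eq_square mult_ac)
qed

text \<open>Lines and hyperplanes use the union bound over incidences, giving the quadratic term;
  the other dimensions use the bound over points, giving the linear term. Adding both yields one
  formula for all cases.\<close>

lemma incidence_prob_upper:
  assumes "0 \<le> p" "p \<le> 1"
  shows "incidence_prob K n m p \<le> 2 * (p / threshold m)\<^sup>2 + p / threshold m"
proof (cases "m \<in> {1, n - 1}")
  case True
  have "incidence_prob K n m p \<le> p\<^sup>2 * (real q ^ n * card (subspaces m))"
    by (rule incidence_prob_le_incidences[OF assms])
  also have "\<dots> \<le> p\<^sup>2 * (real q ^ n * real (2 * q ^ (n - 1)))"
    using card_subspaces_le[OF True] by (intro mult_left_mono) (auto simp del: of_nat_mult)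
  also have "\<dots> = 2 * (p / threshold m)\<^sup>2 * ((threshold m)\<^sup>2 * (real q ^ n * real q ^ (n - 1)))"
    using threshold_pos[of m] by (simp add: field_simps)
  also have "\<dots> = 2 * (p / threshold m)\<^sup>2"
    by (simp only: threshold_power2[OF True] mult_1_right)
  finally show ?thesis
    using assms threshold_pos[of m] by (simp add: add_increasing2)
next
  case False
  have "incidence_prob K n m p \<le> p * real q ^ n"
    by (rule incidence_prob_le_points[OF assms])
  also have "\<dots> = p / threshold m"
    using False q_ge_2 by (simp add: threshold_def powr_minus powr_realpow field_simps)
  finally show ?thesis by (simp add: add_increasing)
qed

text \<open>With \<open>p = r * threshold m\<close>, each denominator is a power of \<open>r\<close>
  times a factor that the two preceding estimates show to be at least 1, so the factor may be
  dropped.\<close>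

lemma incidence_prob_lower:
  assumes "0 < p" "p \<le> 1"
  shows "1 - (1 / (p / threshold m)\<^sup>2 + 2 / (p / threshold m)) \<le> incidence_prob K n m p"
proof -
  define r where "r = p / threshold m"
  have r: "0 < r" "p = r * threshold m"
    using assms threshold_pos[of m] by (auto simp: r_def)
  have aux: "a / (x * c) \<le> a / x" if "0 \<le> a" "0 < x" "1 \<le> c" for a x c :: real
    using that by (intro frac_le) (simp_all add: mult_le_cancel_left1)
  have "1 / (p\<^sup>2 * (real q ^ n * card (subspaces m)))
      = 1 / (r\<^sup>2 * ((threshold m)\<^sup>2 * (real q ^ n * card (subspaces m))))"
    by (simp add: r power_mult_distrib mult_ac)
  also have "\<dots> \<le> 1 / r\<^sup>2"
    using threshold_mult_incidences_ge r by (intro aux) auto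
  finally have 1: "1 / (p\<^sup>2 * (real q ^ n * card (subspaces m))) \<le> 1 / r\<^sup>2" .
  have "2 / (p * real q ^ n) = 2 / (r * (threshold m * real q ^ n))"
    by (simp add: r mult_ac)
  also have "\<dots> \<le> 2 / r"
    using threshold_mult_points_ge r by (intro aux) auto
  finally show ?thesis
    using 1 incidence_prob_ge[of p m] assms m by (simp flip: r_def)
qed

end

end

section \<open>Passage to the limit along the sequence of fields and dimensions\<close>

theorem theorem1p9:
  fixes m n q :: "nat \<Rightarrow> nat" and K :: "nat \<Rightarrow> 'a ring"
  assumes "\<And>k. 1 \<le> m k" and "\<And>k. m k < n k"
    and "\<And>k. primepow (q k)"
    and "\<And>k. field (K k)" and "\<And>k. finite (carrier (K k))" and "\<And>k. card (carrier (K k)) = q k"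
    and "filterlim (\<lambda>k. n k + q k) at_top sequentially"
  shows "is_threshold (\<lambda>k \<theta>. incidence_prob (K k) (n k) (m k) \<theta>)
    (\<lambda>k. if m k \<in> {1, n k - 1}
         then real (q k) powr (- (1/2) * ((real (n k) - real (m k)) * (real (m k) + 1) + real (m k)))
         else real (q k) powr (- real (n k)))"
    (is "is_threshold ?P ?t")
proof -
  \<comment> \<open>The locale assumptions concern only the field; the dimension \<open>n k\<close>
    is supplied to each fact separately.\<close>
  have space: "finite_coord_space (K k)" for k
    using assms by (simp add: finite_coord_space_def finite_coord_space_axioms_def)
  define t where "t = ?t"
  have t_eq: "t k = finite_coord_space.threshold (K k) (n k) (m k)" for k
    unfolding t_def finite_coord_space.threshold_def[OF space] assms(6) ..
  have pos: "0 < t k" for k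
    unfolding t_eq by (rule finite_coord_space.threshold_pos[OF space])
  have upper: "?P k p \<le> 2 * (p / t k)\<^sup>2 + p / t k" if "0 \<le> p" "p \<le> 1" for k p
    unfolding t_eq using that assms(1,2)
    by (intro finite_coord_space.incidence_prob_upper[OF space])
  have lower: "1 - (1 / (p / t k)\<^sup>2 + 2 / (p / t k)) \<le> ?P k p" if "0 < p" "p \<le> 1" for k p
    unfolding t_eq using that assms(1,2)
    by (intro finite_coord_space.incidence_prob_lower[OF space])
  have prob: "0 \<le> ?P k p" "?P k p \<le> 1" for k p
    by (simp_all add: incidence_prob_def)
  show ?thesis
    unfolding is_threshold_def t_def[symmetric]
  proof (intro allI impI conjI)
    fix \<theta> :: "nat \<Rightarrow> real" assume \<theta>: "\<forall>k. 0 \<le> \<theta> k \<and> \<theta> k \<le> 1"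
    {
      assume "\<theta> \<in> o(t)"
      then have lim: "(\<lambda>k. \<theta> k / t k) \<longlonglongrightarrow> 0" by (rule smalloD_tendsto)
      \<comment> \<open>The upper bound depends on \<open>k\<close> only through the ratio
        \<open>\<theta> k / t k\<close>, so it is uniform in \<open>m\<close>, \<open>n\<close> and
        \<open>q\<close>.\<close>
      have "(\<lambda>k. 2 * (\<theta> k / t k)\<^sup>2 + \<theta> k / t k) \<longlonglongrightarrow> 2 * 0\<^sup>2 + 0"
        by (intro tendsto_intros lim)
      then have lim': "(\<lambda>k. 2 * (\<theta> k / t k)\<^sup>2 + \<theta> k / t k) \<longlonglongrightarrow> 0" by simp
      show "(\<lambda>k. ?P k (\<theta> k)) \<longlonglongrightarrow> 0"
        by (rule tendsto_sandwich[OF _ _ tendsto_const lim'])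
          (use \<theta> upper prob in auto)
    }
    {
      assume "\<theta> \<in> \<omega>(t)"
      then have "filterlim (\<lambda>k. norm (\<theta> k / t k)) at_top sequentially"
        by (rule smallomegaD_filterlim_at_top_norm) (simp add: less_imp_neq[OF pos, THEN not_sym])
      moreover have "norm (\<theta> k / t k) = \<theta> k / t k" for k
        using \<theta> pos[of k] by simp
      ultimately have lim: "filterlim (\<lambda>k. \<theta> k / t k) at_top sequentially" by simp
      have "(\<lambda>k. 1 - (1 / (\<theta> k / t k)\<^sup>2 + 2 / (\<theta> k / t k))) \<longlonglongrightarrow> 1 - (0 + 0)"
        by (intro tendsto_intros tendsto_divide_0[OF tendsto_const] filterlim_at_top_imp_at_infinity
            filterlim_pow_at_top lim) auto
      then have lim': "(\<lambda>k. 1 - (1 / (\<theta> k / t k)\<^sup>2 + 2 / (\<theta> k / t k))) \<longlonglongrightarrow> 1" by simp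
      \<comment> \<open>The lower bound needs a positive density; \<open>\<theta>\<close> may vanish
        at finitely many indices.\<close>
      have ev: "eventually (\<lambda>k. 0 < \<theta> k / t k) sequentially"
        using lim by (simp add: filterlim_at_top_dense)
      have "eventually (\<lambda>k. 1 - (1 / (\<theta> k / t k)\<^sup>2 + 2 / (\<theta> k / t k)) \<le> ?P k (\<theta> k)) sequentially"
        using ev
      proof eventually_elim
        case (elim k)
        then have "0 < \<theta> k" using pos[of k] by (simp add: zero_less_divide_iff)
        then show ?case using lower[of "\<theta> k" k] \<theta> by simp
      qed
      then show "(\<lambda>k. ?P k (\<theta> k)) \<longlonglongrightarrow> 1"
        by (rule tendsto_sandwich[OF _ _ lim' tendsto_const]) (use prob in auto)
    }
  qed
qed

end
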